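(* Let $\pi=\{1,q\}$ be a monoid with unit $1=1_\pi$ and $q^2=q$. Let $\mathcal{A}$ be an algebra over $K$, $\lambda\in K$, and assume that $(\mathcal{A},\mathcal{R})$ and $(\mathcal{A},\mathcal{R}')$ are Rota-Baxter algebras of weight $\lambda$. Define $R_{1_\pi}:\mathcal{A}1_\pi\to\mathcal{A}1_\pi$ by $R_{1_\pi}(h1_\pi)=\mathcal{R}(h)1_\pi$ and $R_q:\mathcal{A}q\to\mathcal{A}q$ by $R_q(hq)=\mathcal{R}'(h)q$, for all $h\in\mathcal{A}$. Then $(\mathcal{A}[\pi],\{R_\varphi\}_{\varphi\in\pi},\lambda)$ is a Rota-Baxter T-algebra of weight $\lambda$ if and only if $(\mathcal{R},\mathcal{R}')$ is a Rota-Baxter pair of weight $\lambda$ on $\mathcal{A}$.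
   Context: $K$ is a field; all vector spaces, tensor products and linear maps are over $K$; algebras are associative. A Rota-Baxter algebra of weight $\lambda\in K$ is an algebra $\mathcal{A}$ with a linear map $\mathcal{R}:\mathcal{A}\to\mathcal{A}$ such that $\mathcal{R}(a)\mathcal{R}(b)=\mathcal{R}(a\mathcal{R}(b))+\mathcal{R}(\mathcal{R}(a)b)+\lambda\mathcal{R}(ab)$ for all $a,b\in\mathcal{A}$. If $(\mathcal{A},\mathcal{R})$ and $(\mathcal{A},\mathcal{R}')$ are Rota-Baxter algebras of weight $\lambda$, the pair $(\mathcal{R},\mathcal{R}')$ is a Rota-Baxter pair of weight $\lambda$ if for all $h,g\in\mathcal{A}$: $\mathcal{R}(h)\mathcal{R}'(g)=\mathcal{R}'(\mathcal{R}(h)g+h\mathcal{R}'(g)+\lambda hg)$ and $\mathcal{R}'(h)\mathcal{R}(g)=\mathcal{R}'(\mathcal{R}'(h)g+h\mathcal{R}(g)+\lambda hg)$. For a semigroup $\pi$, a T-algebra is a family of vector spaces $\{A_\varphi\}_{\varphi\in\pi}$ with linear maps $\mu_{p,q}:A_p\otimes A_q\to A_{pq}$ ($p,q\in\pi$), written $\mu_{p,q}(a\otimes b)=a\cdot_{p,q}b$, such that $(a\cdot_{p,q}b)\cdot_{pq,t}c=a\cdot_{p,qt}(b\cdot_{q,t}c)$ for all $p,q,t\in\pi$, $a\in A_p,b\in A_q,c\in A_t$. A Rota-Baxter T-algebra of weight $\lambda$ is a T-algebra with a family of linear maps $\{R_\varphi:A_\varphi\to A_\varphi\}_{\varphi\in\pi}$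 such that $R_p(a)\cdot_{p,q}R_q(b)=R_{pq}\big(R_p(a)\cdot_{p,q}b+a\cdot_{p,q}R_q(b)+\lambda\, a\cdot_{p,q}b\big)$ for all $p,q\in\pi$, $a\in A_p$, $b\in A_q$. Write $\mathcal{A}[\pi]=\mathcal{A}\otimes K\pi$, $\mathcal{A}\varphi=\mathcal{A}\otimes K\varphi$ and $h\varphi=h\otimes\varphi$ for $\varphi\in\pi$, $h\in\mathcal{A}$; $\mathcal{A}[\pi]$ is regarded as the T-algebra with components $\{\mathcal{A}\varphi\}_{\varphi\in\pi}$ and multiplications $\mathcal{A}p\otimes\mathcal{A}r\to\mathcal{A}(pr)$, $(hp)\cdot_{p,r}(gr)=(hg)(pr)$, for $p,r\in\pi$. *)

theory Defs
  imports Complex_Main "HOL-Library.Poly_Mapping"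
begin

section \<open>Algebras, Rota-Baxter algebras and Rota-Baxter pairs\<close>

text \<open>Associative algebras need not have a unit: the class \<open>ring\<close> is that of non-unital rings.\<close>

locale assoc_algebra = vector_space scale
  for scale :: "'k::field \<Rightarrow> 'a::ring \<Rightarrow> 'a" (infixr \<open>*s\<close> 75) +
  assumes scale_mult_left: "(c *s a) * b = c *s (a * b)"
    and scale_mult_right: "a * (c *s b) = c *s (a * b)"

locale rota_baxter_algebra =
  assoc_algebra scale + Vector_Spaces.linear scale scale R
  for scale :: "'k::field \<Rightarrow> 'a::ring \<Rightarrow> 'a" (infixr \<open>*s\<close> 75)
    and lam :: 'k and R :: "'a \<Rightarrow> 'a" +
  assumes rota_baxter: "R a * R b = R (a * R b) + R (R a * b) + lam *s R (a * b)"

locale rota_baxter_pair =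
  RB: rota_baxter_algebra scale lam R + RB': rota_baxter_algebra scale lam R'
  for scale :: "'k::field \<Rightarrow> 'a::ring \<Rightarrow> 'a" (infixr \<open>*s\<close> 75)
    and lam :: 'k and R R' :: "'a \<Rightarrow> 'a" +
  assumes pair_left: "R h * R' g = R' (R h * g + h * R' g + lam *s (h * g))"
    and pair_right: "R' h * R g = R' (R' h * g + h * R g + lam *s (h * g))"

section \<open>T-algebras\<close>

definition linear_on ::
  "('k \<Rightarrow> 'b \<Rightarrow> 'b) \<Rightarrow> 'b set \<Rightarrow> 'b set \<Rightarrow> ('b \<Rightarrow> 'b::ab_group_add) \<Rightarrow> bool" where
  "linear_on s S T f \<longleftrightarrow> f ` S \<subseteq> T \<and>
     (\<forall>x\<in>S. \<forall>y\<in>S. f (x + y) = f x + f y) \<and> (\<forall>c. \<forall>x\<in>S. f (s c x) = s c (f x))"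

text \<open>
  The vector spaces of the family are subspaces \<open>A p\<close> of one ambient space (up to isomorphism this
  is no restriction: embed the family into its direct sum); they need not be independent.
  A linear map on \<open>A p \<otimes> A q\<close> is given by the bilinear map \<open>mu p q\<close> on \<open>A p \<times> A q\<close>.
  The values of \<open>mu p q\<close> and of \<open>R p\<close> below outside these subspaces are irrelevant.
\<close>

locale t_algebra = vector_space scale
  for scale :: "'k::field \<Rightarrow> 'b::ab_group_add \<Rightarrow> 'b" (infixr \<open>*s\<close> 75)
    and A :: "'p::semigroup_mult \<Rightarrow> 'b set"
    and mu :: "'p \<Rightarrow> 'p \<Rightarrow> 'b \<Rightarrow> 'b \<Rightarrow> 'b" +
  assumes subspace_component: "subspace (A p)"
    and mu_linear_right: "a \<in> A p \<Longrightarrow> linear_on scale (A q) (A (p * q)) (\<lambda>b. mu p q a b)"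
    and mu_linear_left: "b \<in> A q \<Longrightarrow> linear_on scale (A p) (A (p * q)) (\<lambda>a. mu p q a b)"
    and mu_assoc: "a \<in> A p \<Longrightarrow> b \<in> A q \<Longrightarrow> c \<in> A t \<Longrightarrow>
      mu (p * q) t (mu p q a b) c = mu p (q * t) a (mu q t b c)"

locale rota_baxter_t_algebra = t_algebra scale A mu
  for scale :: "'k::field \<Rightarrow> 'b::ab_group_add \<Rightarrow> 'b" (infixr \<open>*s\<close> 75)
    and A :: "'p::semigroup_mult \<Rightarrow> 'b set"
    and mu :: "'p \<Rightarrow> 'p \<Rightarrow> 'b \<Rightarrow> 'b \<Rightarrow> 'b"
    and lam :: 'k and R :: "'p \<Rightarrow> 'b \<Rightarrow> 'b" +
  assumes R_linear: "linear_on scale (A p) (A p) (R p)"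
    and rota_baxter_t: "a \<in> A p \<Longrightarrow> b \<in> A q \<Longrightarrow>
      mu p q (R p a) (R q b) = R (p * q) (mu p q (R p a) b + mu p q a (R q b) + lam *s mu p q a b)"

section \<open>The tensor product of a vector space with a semigroup algebra\<close>

text \<open>
  The vector space \<open>K\<pi>\<close> is \<open>'p \<Rightarrow>\<^sub>0 'k\<close> with basis vectors \<open>Poly_Mapping.single p 1\<close>. The tensor product
  \<open>\<A> \<otimes> K\<pi>\<close> is realised as \<open>'p \<Rightarrow>\<^sub>0 'a\<close>, where \<open>h \<otimes> x\<close> is the function taking \<open>p\<close> to \<open>x(p) h\<close>; that
  this is a tensor product is the universal property \<open>tensor_universal\<close>.
\<close>

definition scale_pm :: "('k \<Rightarrow> 'a \<Rightarrow> 'a) \<Rightarrow> 'k \<Rightarrow> ('p \<Rightarrow>\<^sub>0 'a::zero) \<Rightarrow> ('p \<Rightarrow>\<^sub>0 'a)" where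
  "scale_pm s c = Poly_Mapping.map (s c)"

definition tensor :: "('k::zero \<Rightarrow> 'a::zero \<Rightarrow> 'a) \<Rightarrow> 'a \<Rightarrow> ('p \<Rightarrow>\<^sub>0 'k) \<Rightarrow> ('p \<Rightarrow>\<^sub>0 'a)" where
  "tensor s h x = Poly_Mapping.map (\<lambda>c. s c h) x"

definition elem :: "('k::zero_neq_one \<Rightarrow> 'a::zero \<Rightarrow> 'a) \<Rightarrow> 'a \<Rightarrow> 'p \<Rightarrow> ('p \<Rightarrow>\<^sub>0 'a)" where
  "elem s h p = tensor s h (Poly_Mapping.single p 1)"

text \<open>The component \<open>\<A>p = \<A> \<otimes> Kp\<close> inside \<open>\<A> \<otimes> K\<pi>\<close>, with \<open>Kp\<close> the line spanned by \<open>p\<close> in \<open>K\<pi>\<close>.\<close>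

definition component :: "('k::field \<Rightarrow> 'a::ab_group_add \<Rightarrow> 'a) \<Rightarrow> 'p \<Rightarrow> ('p \<Rightarrow>\<^sub>0 'a) set" where
  "component s p = module.span (scale_pm s)
     {tensor s h x | h x. x \<in> module.span (scale_pm (*)) {Poly_Mapping.single p (1::'k)}}"

text \<open>By \<open>elem_eq_single\<close>, this is \<open>(hp)(gr) = (hg)(pr)\<close>; see \<open>component_mult_elem\<close>.\<close>

definition component_mult ::
  "'p::semigroup_mult \<Rightarrow> 'p \<Rightarrow> ('p \<Rightarrow>\<^sub>0 'a::ring) \<Rightarrow> ('p \<Rightarrow>\<^sub>0 'a) \<Rightarrow> ('p \<Rightarrow>\<^sub>0 'a)" where
  "component_mult p r x y = Poly_Mapping.single (p * r) (Poly_Mapping.lookup x p * Poly_Mapping.lookup y r)"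

context vector_space
begin

lemma lookup_scale_pm: "Poly_Mapping.lookup (scale_pm scale c x) p = c *s Poly_Mapping.lookup x p"
  by (simp add: scale_pm_def map.rep_eq when_def)

lemma lookup_tensor: "Poly_Mapping.lookup (tensor scale h x) p = Poly_Mapping.lookup x p *s h"
  by (simp add: tensor_def map.rep_eq when_def)

lemma elem_eq_single: "elem scale h p = Poly_Mapping.single p h"
  by (rule poly_mapping_eqI) (simp add: elem_def lookup_tensor lookup_single when_def)

lemma vector_space_scale_pm: "vector_space (scale_pm scale :: 'a \<Rightarrow> ('p \<Rightarrow>\<^sub>0 'b) \<Rightarrow> _)"
  by unfold_locales
    (auto intro!: poly_mapping_eqI
      simp: lookup_scale_pm lookup_add scale_right_distrib scale_left_distrib)

end

lemma poly_mapping_decomp: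
  fixes y :: "'p \<Rightarrow>\<^sub>0 'c::comm_monoid_add"
  shows "y = (\<Sum>p\<in>Poly_Mapping.keys y. Poly_Mapping.single p (Poly_Mapping.lookup y p))"
  by (rule poly_mapping_eqI) (auto simp: lookup_sum lookup_single when_def in_keys_iff)

lemma vector_space_scale_field: "vector_space ((*) :: 'k::field \<Rightarrow> 'k \<Rightarrow> 'k)"
  by unfold_locales (auto simp: algebra_simps)

context vector_space
begin

lemma span_basis_vector:
  "module.span (scale_pm (*)) {Poly_Mapping.single p (1::'a)} = range (Poly_Mapping.single p)"
proof -
  interpret F: vector_space "(*) :: 'a \<Rightarrow> 'a \<Rightarrow> 'a"
    by (rule vector_space_scale_field)
  interpret P: vector_space "scale_pm (*) :: 'a \<Rightarrow> ('c \<Rightarrow>\<^sub>0 'a) \<Rightarrow> _"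
    by (rule F.vector_space_scale_pm)
  have "scale_pm (*) c (Poly_Mapping.single p (1::'a)) = Poly_Mapping.single p c" for c
    by (rule poly_mapping_eqI) (simp add: F.lookup_scale_pm lookup_single when_def)
  then show ?thesis
    by (simp add: P.span_singleton)
qed

lemma component_eq: "component scale p = range (\<lambda>h. elem scale h p)"
proof -
  interpret T: vector_space "scale_pm scale :: 'a \<Rightarrow> ('c \<Rightarrow>\<^sub>0 'b) \<Rightarrow> _"
    by (rule vector_space_scale_pm)
  have t: "tensor scale h (Poly_Mapping.single p c) = Poly_Mapping.single p (c *s h)" for h c
    by (rule poly_mapping_eqI) (simp add: lookup_tensor lookup_single when_def)
  have sc: "scale_pm scale c (Poly_Mapping.single p h) = Poly_Mapping.single p (c *s h)" for h c
    by (rule poly_mapping_eqI) (simp add: lookup_scale_pm lookup_single when_def)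
  have "{tensor scale h x | h x. x \<in> range (Poly_Mapping.single p)} = range (Poly_Mapping.single p)"
    by (auto simp: t) (metis scale_one rangeI t)
  moreover have "T.subspace (range (Poly_Mapping.single p))"
    by (rule T.subspaceI)
      (auto simp: sc single_add[symmetric] intro: range_eqI[of _ _ 0])
  ultimately show ?thesis
    by (simp add: component_def span_basis_vector elem_eq_single T.span_eq_iff)
qed

lemma tensor_bilinear:
  fixes x :: "'p \<Rightarrow>\<^sub>0 'a"
  shows "Vector_Spaces.linear (scale_pm (*)) (scale_pm scale) (tensor scale h :: ('p \<Rightarrow>\<^sub>0 'a) \<Rightarrow> _)"
    and "Vector_Spaces.linear scale (scale_pm scale) (\<lambda>h. tensor scale h x)"
proof -
  interpret F: vector_space "(*) :: 'a \<Rightarrow> 'a \<Rightarrow> 'a"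
    by (rule vector_space_scale_field)
  interpret P: vector_space "scale_pm (*) :: 'a \<Rightarrow> ('p \<Rightarrow>\<^sub>0 'a) \<Rightarrow> _"
    by (rule F.vector_space_scale_pm)
  interpret T: vector_space "scale_pm scale :: 'a \<Rightarrow> ('p \<Rightarrow>\<^sub>0 'b) \<Rightarrow> _"
    by (rule vector_space_scale_pm)
  show "Vector_Spaces.linear (scale_pm (*)) (scale_pm scale) (tensor scale h :: ('p \<Rightarrow>\<^sub>0 'a) \<Rightarrow> _)"
    by unfold_locales (auto intro!: poly_mapping_eqI
      simp: lookup_tensor lookup_scale_pm F.lookup_scale_pm lookup_add scale_left_distrib)
  show "Vector_Spaces.linear scale (scale_pm scale) (\<lambda>h. tensor scale h x)"
    by unfold_locales (auto intro!: poly_mapping_eqI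
      simp: lookup_tensor lookup_scale_pm lookup_add scale_right_distrib mult.commute)
qed

lemma tensor_universal:
  fixes B :: "'b \<Rightarrow> ('p \<Rightarrow>\<^sub>0 'a) \<Rightarrow> 'z::ab_group_add"
  assumes lin1: "\<And>h. Vector_Spaces.linear (scale_pm (*)) scaleZ (B h)"
    and lin2: "\<And>x. Vector_Spaces.linear scale scaleZ (\<lambda>h. B h x)"
  shows "\<exists>!f. Vector_Spaces.linear (scale_pm scale) scaleZ f \<and> (\<forall>h x. f (tensor scale h x) = B h x)"
proof -
  interpret F: vector_space "(*) :: 'a \<Rightarrow> 'a \<Rightarrow> 'a"
    by (rule vector_space_scale_field)
  interpret T: vector_space "scale_pm scale :: 'a \<Rightarrow> ('p \<Rightarrow>\<^sub>0 'b) \<Rightarrow> _"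
    by (rule vector_space_scale_pm)
  interpret Z: vector_space scaleZ
    using lin1[of 0] by (simp add: Vector_Spaces.linear_def)
  interpret B1: Vector_Spaces.linear "scale_pm (*)" scaleZ "B h" for h by (rule lin1)
  interpret B2: Vector_Spaces.linear scale scaleZ "\<lambda>h. B h x" for x by (rule lin2)
  define e where "e p = Poly_Mapping.single p (1::'a)" for p :: 'p
  define f where "f y = (\<Sum>p\<in>Poly_Mapping.keys y. B (Poly_Mapping.lookup y p) (e p))" for y
  have f_eq: "f y = (\<Sum>p\<in>S. B (Poly_Mapping.lookup y p) (e p))" if "finite S" "Poly_Mapping.keys y \<subseteq> S" for y S
    unfolding f_def
    by (rule sum.mono_neutral_left) (use that in \<open>auto simp: in_keys_iff B2.zero\<close>)
  have sc: "Poly_Mapping.single p c = scale_pm (*) c (e p)" for p c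
    by (rule poly_mapping_eqI) (simp add: e_def F.lookup_scale_pm lookup_single when_def)
  have te: "tensor scale h (e p) = Poly_Mapping.single p h" for h p
    using elem_eq_single by (simp add: e_def elem_def)
  have f_lin: "Vector_Spaces.linear (scale_pm scale) scaleZ f"
  proof unfold_locales
    fix x y :: "'p \<Rightarrow>\<^sub>0 'b" and c
    let ?S = "Poly_Mapping.keys x \<union> Poly_Mapping.keys y"
    show "f (x + y) = f x + f y"
      using f_eq[of ?S x] f_eq[of ?S y] f_eq[of ?S "x + y"] Poly_Mapping.keys_add[of x y]
      by (simp add: lookup_add B2.add sum.distrib)
    have "Poly_Mapping.keys (scale_pm scale c x) \<subseteq> Poly_Mapping.keys x"
      by (auto simp: in_keys_iff lookup_scale_pm)
    then show "f (scale_pm scale c x) = scaleZ c (f x)"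
      using f_eq[of "Poly_Mapping.keys x" x] f_eq[of "Poly_Mapping.keys x" "scale_pm scale c x"]
      by (simp add: lookup_scale_pm B2.scale Z.scale_sum_right)
  qed
  have f_tensor: "f (tensor scale h x) = B h x" for h x
  proof -
    have "Poly_Mapping.keys (tensor scale h x) \<subseteq> Poly_Mapping.keys x"
      by (auto simp: in_keys_iff lookup_tensor)
    then have "f (tensor scale h x) = (\<Sum>p\<in>Poly_Mapping.keys x. scaleZ (Poly_Mapping.lookup x p) (B h (e p)))"
      using f_eq[of "Poly_Mapping.keys x" "tensor scale h x"] by (simp add: lookup_tensor B2.scale)
    also have "\<dots> = B h (\<Sum>p\<in>Poly_Mapping.keys x. Poly_Mapping.single p (Poly_Mapping.lookup x p))"
      by (simp add: B1.sum sc B1.scale)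
    finally show ?thesis using poly_mapping_decomp[of x] by simp
  qed
  show ?thesis
  proof (rule ex1I[of _ f])
    show "Vector_Spaces.linear (scale_pm scale) scaleZ f \<and> (\<forall>h x. f (tensor scale h x) = B h x)"
      using f_lin f_tensor by blast
    fix g assume g: "Vector_Spaces.linear (scale_pm scale) scaleZ g \<and> (\<forall>h x. g (tensor scale h x) = B h x)"
    interpret g: Vector_Spaces.linear "scale_pm scale" scaleZ g using g by blast
    show "g = f"
    proof
      fix y
      have "g y = g (\<Sum>p\<in>Poly_Mapping.keys y. Poly_Mapping.single p (Poly_Mapping.lookup y p))"
        using poly_mapping_decomp[of y] by simp
      also have "\<dots> = (\<Sum>p\<in>Poly_Mapping.keys y. g (tensor scale (Poly_Mapping.lookup y p) (e p)))"
        by (simp add: g.sum te)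
      also have "\<dots> = f y" using g by (simp add: f_def)
      finally show "g y = f y" .
    qed
  qed
qed

end

lemma (in assoc_algebra) component_mult_elem:
  "component_mult p r (elem scale h p) (elem scale g r) = elem scale (h * g) (p * r)"
  by (simp add: component_mult_def elem_eq_single)

end

theory Submission
  imports Defs
begin

text \<open>
  On homogeneous elements \<open>hp\<close>, \<open>gr\<close> the Rota-Baxter identity of a family of operators on \<open>\<A>[\<pi>]\<close> is
  an identity in \<open>\<A>\<close>, one for each \<open>(p, r)\<close>. For \<open>\<pi> = {1, q}\<close> the pairs \<open>(1, 1)\<close> and \<open>(q, q)\<close> give the
  Rota-Baxter identities of \<open>\<R>\<close> and \<open>\<R>'\<close>, while \<open>(1, q)\<close> and \<open>(q, 1)\<close> give the two conditions on a
  Rota-Baxter pair.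
\<close>

context assoc_algebra
begin

lemma elem_add: "elem scale h p + elem scale g p = elem scale (h + g) p"
  by (simp add: elem_eq_single single_add)

lemma scale_pm_elem: "scale_pm scale c (elem scale h p) = elem scale (c *s h) p"
  by (rule poly_mapping_eqI) (simp add: elem_eq_single lookup_scale_pm lookup_single when_def)

lemma elem_eq_iff: "elem scale h p = elem scale g p \<longleftrightarrow> h = g"
  by (metis elem_eq_single lookup_single_eq)

text \<open>By \<open>component_eq\<close> every element of a component is some
  \<open>elem scale h p\<close>, so bilinearity and associativity of \<open>component_mult\<close>
  come down to those of the product of \<A>.\<close>

lemma t_algebra_component:
  "t_algebra (scale_pm scale) (component scale :: 'p::semigroup_mult \<Rightarrow> _) component_mult"
proof -
  interpret T: vector_space "scale_pm scale :: 'k \<Rightarrow> ('p \<Rightarrow>\<^sub>0 'a) \<Rightarrow> _"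
    by (rule vector_space_scale_pm)
  show ?thesis
  proof unfold_locales
    show "T.subspace (component scale p)" for p
      unfolding component_def by (rule T.subspace_span)
  qed (auto simp: component_eq linear_on_def component_mult_elem elem_add scale_pm_elem
      scale_mult_left scale_mult_right distrib_left distrib_right mult.assoc)
qed

text \<open>\<open>Rfam\<close> is prescribed on all of each component, and hp determines h, so
  passing from homogeneous elements to \<A> loses nothing. Linearity of \<open>Rfam p\<close> on its
  component is inherited from \<open>S p\<close>.\<close>

lemma rota_baxter_t_algebra_component_iff:
  fixes S :: "'p::semigroup_mult \<Rightarrow> 'a \<Rightarrow> 'a"
  assumes lin: "\<And>p. Vector_Spaces.linear scale scale (S p)"
    and Rfam: "\<And>p h. Rfam p (elem scale h p) = elem scale (S p h) p"
  shows "rota_baxter_t_algebra (scale_pm scale) (component scale) component_mult lam Rfam \<longleftrightarrow>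
    (\<forall>p r h g. S p h * S r g = S (p * r) (S p h * g + h * S r g + lam *s (h * g)))"
proof -
  interpret S: Vector_Spaces.linear scale scale "S p" for p by (rule lin)
  have Rfam_linear: "linear_on (scale_pm scale) (component scale p) (component scale p) (Rfam p)" for p
    by (auto simp: component_eq linear_on_def elem_add scale_pm_elem Rfam S.add S.scale)
  \<comment> \<open>Both sides lie in the component at \<open>p * r\<close>, and
    \<open>elem_eq_iff\<close> compares their coefficients in \<A>.\<close>
  have homogeneous: "component_mult p r (Rfam p (elem scale h p)) (Rfam r (elem scale g r)) =
      Rfam (p * r) (component_mult p r (Rfam p (elem scale h p)) (elem scale g r)
        + component_mult p r (elem scale h p) (Rfam r (elem scale g r))
        + scale_pm scale lam (component_mult p r (elem scale h p) (elem scale g r)))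
    \<longleftrightarrow> S p h * S r g = S (p * r) (S p h * g + h * S r g + lam *s (h * g))" for p r h g
    by (simp only: Rfam component_mult_elem elem_add scale_pm_elem elem_eq_iff)
  show ?thesis
  proof
    assume "rota_baxter_t_algebra (scale_pm scale) (component scale) component_mult lam Rfam"
    then show "\<forall>p r h g. S p h * S r g = S (p * r) (S p h * g + h * S r g + lam *s (h * g))"
      unfolding homogeneous[symmetric]
      by (intro allI rota_baxter_t_algebra.rota_baxter_t) (auto simp: component_eq)
  next
    assume *: "\<forall>p r h g. S p h * S r g = S (p * r) (S p h * g + h * S r g + lam *s (h * g))"
    show "rota_baxter_t_algebra (scale_pm scale) (component scale) component_mult lam Rfam"
      by (intro rota_baxter_t_algebra.intro rota_baxter_t_algebra_axioms.intro
          t_algebra_component Rfam_linear)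
        (use * in \<open>auto simp only: component_eq homogeneous\<close>)
  qed
qed

end

theorem theorem2p19:
  fixes scale :: "'k::field \<Rightarrow> 'a::ring \<Rightarrow> 'a"
    and lam :: 'k
    and R R' :: "'a \<Rightarrow> 'a"
    and q :: "'p::monoid_mult"
    and Rfam :: "'p \<Rightarrow> ('p \<Rightarrow>\<^sub>0 'a) \<Rightarrow> ('p \<Rightarrow>\<^sub>0 'a)"
  assumes "(UNIV :: 'p set) = {1, q}" and "q \<noteq> 1" and "q * q = q"
    and "rota_baxter_algebra scale lam R"
    and "rota_baxter_algebra scale lam R'"
    and "\<And>h. Rfam 1 (elem scale h 1) = elem scale (R h) 1"
    and "\<And>h. Rfam q (elem scale h q) = elem scale (R' h) q"
  shows "rota_baxter_t_algebra (scale_pm scale) (component scale) component_mult lam Rfam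
     \<longleftrightarrow> rota_baxter_pair scale lam R R'"
proof -
  interpret RB: rota_baxter_algebra scale lam R by fact
  interpret RB': rota_baxter_algebra scale lam R' by fact
  \<comment> \<open>As \<open>1\<close> and \<open>q\<close> exhaust the type, the else branch
    concerns \<open>q\<close> alone.\<close>
  define S where "S p = (if p = 1 then R else R')" for p :: 'p
  have S: "S 1 = R" "S q = R'"
    using \<open>q \<noteq> 1\<close> by (simp_all add: S_def)
  have all: "(\<forall>p. P p) \<longleftrightarrow> P 1 \<and> P q" for P :: "'p \<Rightarrow> bool"
    using assms(1) by (metis UNIV_I insertE singletonD)
  have lin: "Vector_Spaces.linear scale scale (S p)" for p
    unfolding S_def by (simp add: RB.linear_axioms RB'.linear_axioms)
  have "\<forall>p h. Rfam p (elem scale h p) = elem scale (S p h) p"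
    unfolding all by (simp add: S assms(6,7))
  then have "rota_baxter_t_algebra (scale_pm scale) (component scale) component_mult lam Rfam \<longleftrightarrow>
    (\<forall>p r h g. S p h * S r g =
      S (p * r) (S p h * g + h * S r g + scale lam (h * g)))"
    using RB.rota_baxter_t_algebra_component_iff[where S = S, OF lin] by blast
  also have "\<dots> \<longleftrightarrow> rota_baxter_pair scale lam R R'"
    \<comment> \<open>Four identities remain. A product in the monoid is \<open>1\<close> only for
      the pair (1, 1), so \<open>R'\<close> is the outer operator in the other three. Linearity
      matches an operator applied to a sum with the three separate terms in
      \<open>rota_baxter\<close>, which settles (1, 1) and (q, q).\<close>
    unfolding all
    by (auto simp: S \<open>q * q = q\<close> rota_baxter_pair_def rota_baxter_pair_axioms_def assms(4,5)
        RB.rota_baxter RB'.rota_baxter RB.add RB.scale RB'.add RB'.scale add_ac)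
  finally show ?thesis .
qed

end
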